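(* Let $R_4=\mathbb Z[a,b,c,d,d^{-1}]$ and let $H_4$ be the quotient of the group algebra $R_4B_3$ of the braid group $B_3=\langle s_1,s_2\mid s_1s_2s_1=s_2s_1s_2\rangle$ by the relations $s_i^4=as_i^3+bs_i^2+cs_i+d$, $i=1,2$. Let $u_i$ be the $R_4$-subalgebra of $H_4$ generated by $s_i$, let $\omega=s_2s_1^2s_2$, and let $$U=u_1u_2u_1+u_1s_2s_1^{-1}s_2u_1+u_1s_2^{-1}s_1s_2^{-1}u_1+u_1s_2^{-1}s_1^{-2}s_2^{-1}+u_1s_2s_1^{-2}s_2u_1+u_1s_2^{-2}s_1^{-2}s_2^{-2}u_1 .$$ Then: (i) $U=u_1u_2u_1+u_1s_2s_1^{-1}s_2u_1+u_1s_2^{-1}s_1s_2^{-1}u_1+u_1\omega+u_1\omega^{-1}+u_1\omega^{-2}$. (ii) $H_4=U$.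
   Context: Generators $s_1,s_2$ are identified with their images in $H_4$; they are invertible there since $d$ is invertible in $R_4$. For subsets $X,Y$ of the algebra, $XY$ denotes the $R_4$-submodule spanned by the products $xy$. *)

theory Defs
  imports Complex_Main "HOL-Library.Poly_Mapping" "HOL-Library.Product_Plus" "HOL-Library.Set_Algebras"
begin

section \<open>The braid group on three strands\<close>

datatype gen = Gen1 | Gen2

text \<open>A letter is a generator together with a sign; \<open>True\<close> stands for the generator itself and
  \<open>False\<close> for its formal inverse.\<close>

type_synonym letter = "gen \<times> bool"

inductive braid_eq :: "letter list \<Rightarrow> letter list \<Rightarrow> bool" where
  braid_refl: "braid_eq w w"
| braid_sym: "braid_eq v w \<Longrightarrow> braid_eq w v"
| braid_trans: "braid_eq u v \<Longrightarrow> braid_eq v w \<Longrightarrow> braid_eq u w"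
| braid_cancel: "braid_eq (u @ [(g, e), (g, \<not> e)] @ v) (u @ v)"
| braid_rel: "braid_eq (u @ [(Gen1, True), (Gen2, True), (Gen1, True)] @ v)
                       (u @ [(Gen2, True), (Gen1, True), (Gen2, True)] @ v)"

lemma braid_eq_append_left: "braid_eq v w \<Longrightarrow> braid_eq (u @ v) (u @ w)"
proof (induction rule: braid_eq.induct)
  case (braid_cancel u' g e v)
  then show ?case using braid_eq.braid_cancel[of "u @ u'"] by simp
next
  case (braid_rel u' v)
  then show ?case using braid_eq.braid_rel[of "u @ u'"] by simp
next
  case (braid_trans v w z)
  then show ?case by (blast intro: braid_eq.braid_trans)
qed (simp_all add: braid_refl braid_sym)

lemma braid_eq_append_right: "braid_eq v w \<Longrightarrow> braid_eq (v @ u) (w @ u)"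
proof (induction rule: braid_eq.induct)
  case (braid_cancel u' g e v)
  then show ?case using braid_eq.braid_cancel[of u' g e "v @ u"] by simp
next
  case (braid_rel u' v)
  then show ?case using braid_eq.braid_rel[of u' "v @ u"] by simp
next
  case (braid_trans v w z)
  then show ?case by (blast intro: braid_eq.braid_trans)
qed (simp_all add: braid_refl braid_sym)

definition word_inv :: "letter list \<Rightarrow> letter list" where
  "word_inv w = rev (map (\<lambda>(g, e). (g, \<not> e)) w)"

lemma word_inv_append: "word_inv (v @ w) = word_inv w @ word_inv v"
  by (simp add: word_inv_def)

lemma braid_eq_word_inv_left: "braid_eq (word_inv w @ w) []"
proof (induction w)
  case Nil
  then show ?case by (simp add: word_inv_def braid_refl)
next
  case (Cons l w)
  obtain g e where l: "l = (g, e)" by (cases l)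
  have "braid_eq (word_inv w @ [(g, \<not> e), (g, \<not> \<not> e)] @ w) (word_inv w @ w)"
    by (rule braid_cancel)
  then have "braid_eq (word_inv (l # w) @ l # w) (word_inv w @ w)"
    by (simp add: word_inv_def l)
  then show ?case using Cons.IH by (rule braid_trans)
qed

lemma word_inv_word_inv [simp]: "word_inv (word_inv w) = w"
  by (induction w) (auto simp: word_inv_def rev_map)

lemma braid_eq_word_inv_right: "braid_eq (w @ word_inv w) []"
  using braid_eq_word_inv_left[of "word_inv w"] by simp

lemma braid_eq_word_inv: 
  assumes "braid_eq v w" shows "braid_eq (word_inv v) (word_inv w)"
proof -
  have 1: "braid_eq (word_inv v @ w @ word_inv w) (word_inv v)"
    using braid_eq_append_left[OF braid_eq_word_inv_right, of "word_inv v" w] by simp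
  have "braid_eq (word_inv v @ v @ word_inv w) (word_inv v @ w @ word_inv w)"
    using assms by (intro braid_eq_append_left braid_eq_append_right)
  moreover have "braid_eq (word_inv v @ v @ word_inv w) (word_inv w)"
    using braid_eq_append_right[OF braid_eq_word_inv_left, of v "word_inv w"] by simp
  ultimately show ?thesis using 1 by (blast intro: braid_sym braid_trans)
qed

quotient_type braid3 = "letter list" / braid_eq
proof (rule equivpI)
  show "reflp braid_eq" by (rule reflpI) (rule braid_refl)
  show "symp braid_eq" by (rule sympI) (rule braid_sym)
  show "transp braid_eq" by (rule transpI) (rule braid_trans)
qed

text \<open>The group operation is written additively because the convolution product of
  finitely supported functions is defined over the class \<^class>\<open>monoid_add\<close>, which is not
  assumed to be commutative.\<close>

instantiation braid3 :: group_add
begin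

lift_definition zero_braid3 :: braid3 is "[]" .

lift_definition plus_braid3 :: "braid3 \<Rightarrow> braid3 \<Rightarrow> braid3" is "(@)"
  by (rule braid_trans, erule braid_eq_append_right, erule braid_eq_append_left)

lift_definition uminus_braid3 :: "braid3 \<Rightarrow> braid3" is word_inv
  by (rule braid_eq_word_inv)

definition minus_braid3 :: "braid3 \<Rightarrow> braid3 \<Rightarrow> braid3" where
  "minus_braid3 x y = x + - y"

instance
proof
  fix x y z :: braid3
  show "x + y + z = x + (y + z)" by transfer (simp add: braid_refl)
  show "0 + x = x" by transfer (simp add: braid_refl)
  show "x + 0 = x" by transfer (simp add: braid_refl)
  show "- x + x = 0" by transfer (rule braid_eq_word_inv_left)
  show "x + - y = x - y" by (simp add: minus_braid3_def)
qed

end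

lift_definition braid_gen :: "gen \<Rightarrow> braid3" is "\<lambda>g. [(g, True)]" .


section \<open>The coefficient ring and the group algebra\<close>

text \<open>The ring \<open>\<int>[a, b, c, d, d\<^sup>-\<^sup>1]\<close> is the monoid ring over the integers of the monoid of
  monomials; the exponents of \<open>a\<close>, \<open>b\<close>, \<open>c\<close> are natural numbers and that of \<open>d\<close> is an integer.\<close>

type_synonym R4 = "(nat \<times> nat \<times> nat \<times> int) \<Rightarrow>\<^sub>0 int"

definition par_a :: R4 where "par_a = Poly_Mapping.single (1, 0, 0, 0) 1"
definition par_b :: R4 where "par_b = Poly_Mapping.single (0, 1, 0, 0) 1"
definition par_c :: R4 where "par_c = Poly_Mapping.single (0, 0, 1, 0) 1"
definition par_d :: R4 where "par_d = Poly_Mapping.single (0, 0, 0, 1) 1"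

type_synonym R4B3 = "braid3 \<Rightarrow>\<^sub>0 R4"

definition grp_scalar :: "R4 \<Rightarrow> R4B3" where
  "grp_scalar r = Poly_Mapping.single 0 r"

definition grp_elem :: "braid3 \<Rightarrow> R4B3" where
  "grp_elem g = Poly_Mapping.single g 1"

lemma grp_scalar_add: "grp_scalar (r + r') = grp_scalar r + grp_scalar r'"
  and grp_scalar_mult: "grp_scalar (r * r') = grp_scalar r * grp_scalar r'"
  and grp_scalar_1: "grp_scalar 1 = 1"
  by (simp_all add: grp_scalar_def single_add mult_single)

lemma grp_elem_add: "grp_elem (g + h) = grp_elem g * grp_elem h"
  and grp_elem_0: "grp_elem 0 = 1"
  by (simp_all add: grp_elem_def mult_single)


section \<open>The Hecke algebra\<close>

inductive_set two_sided_ideal :: "'a::ring_1 set \<Rightarrow> 'a set" for S :: "'a set" where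
  ideal_0: "0 \<in> two_sided_ideal S"
| ideal_gen: "x \<in> S \<Longrightarrow> l * x * r \<in> two_sided_ideal S"
| ideal_add: "x \<in> two_sided_ideal S \<Longrightarrow> y \<in> two_sided_ideal S \<Longrightarrow> x + y \<in> two_sided_ideal S"

lemma ideal_mult_left: "x \<in> two_sided_ideal S \<Longrightarrow> l * x \<in> two_sided_ideal S"
proof (induction rule: two_sided_ideal.induct)
  case (ideal_gen x l' r)
  then show ?case using two_sided_ideal.ideal_gen[of x S "l * l'" r] by (simp add: mult.assoc)
qed (simp_all add: ring_distribs two_sided_ideal.intros)

lemma ideal_mult_right: "x \<in> two_sided_ideal S \<Longrightarrow> x * r \<in> two_sided_ideal S"
proof (induction rule: two_sided_ideal.induct)
  case (ideal_gen x l r')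
  then show ?case using two_sided_ideal.ideal_gen[of x S l "r' * r"] by (simp add: mult.assoc)
qed (simp_all add: ring_distribs two_sided_ideal.intros)

lemma ideal_uminus: "x \<in> two_sided_ideal S \<Longrightarrow> - x \<in> two_sided_ideal S"
  using ideal_mult_left[of x S "- 1"] by simp

lemma ideal_diff:
  "x \<in> two_sided_ideal S \<Longrightarrow> y \<in> two_sided_ideal S \<Longrightarrow> x - y \<in> two_sided_ideal S"
  using ideal_add[of x S "- y"] ideal_uminus[of y S] by simp

definition hecke_rel :: "gen \<Rightarrow> R4B3" where
  "hecke_rel g = (let s = grp_elem (braid_gen g) in
     s ^ 4 - (grp_scalar par_a * s ^ 3 + grp_scalar par_b * s ^ 2 + grp_scalar par_c * s
              + grp_scalar par_d))"

definition hecke_ideal :: "R4B3 set" where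
  "hecke_ideal = two_sided_ideal (range hecke_rel)"

quotient_type H4 = R4B3 / "\<lambda>x y. x - y \<in> hecke_ideal"
proof (rule equivpI)
  show "reflp (\<lambda>x y. x - y \<in> hecke_ideal)"
    by (simp add: reflp_def hecke_ideal_def ideal_0)
  show "symp (\<lambda>x y. x - y \<in> hecke_ideal)"
    unfolding hecke_ideal_def by (rule sympI) (drule ideal_uminus, simp)
  show "transp (\<lambda>x y. x - y \<in> hecke_ideal)"
    unfolding hecke_ideal_def by (rule transpI) (drule (1) ideal_add, simp)
qed

text \<open>The sum of all coefficients, used to see that the Hecke algebra is not the zero ring:
  specialising the parameters and the generators to 1 sends the ideal into the
  multiples of 3.\<close>

definition coeff_sum :: "('a \<Rightarrow>\<^sub>0 'b::comm_monoid_add) \<Rightarrow> 'b" where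
  "coeff_sum f = Sum_any (Poly_Mapping.lookup f)"

lemma coeff_sum_add: "coeff_sum (f + g) = coeff_sum f + coeff_sum g"
  by (simp add: coeff_sum_def Poly_Mapping.lookup_add Sum_any.distrib)

lemma coeff_sum_single [simp]: "coeff_sum (Poly_Mapping.single k v) = v"
  by (simp add: coeff_sum_def Poly_Mapping.lookup_single)

lemma coeff_sum_0 [simp]: "coeff_sum 0 = 0"
  by (simp add: coeff_sum_def)

lemma update_conv_add:
  fixes f :: "'a \<Rightarrow>\<^sub>0 'b::monoid_add"
  assumes "k \<notin> Poly_Mapping.keys f"
  shows "Poly_Mapping.update k v f = f + Poly_Mapping.single k v"
  using assms
  by (intro poly_mapping_eqI) (auto simp: Poly_Mapping.lookup_update Poly_Mapping.lookup_add Poly_Mapping.lookup_single in_keys_iff when_def)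

lemma coeff_sum_mult:
  fixes f g :: "'a::monoid_add \<Rightarrow>\<^sub>0 'b::semiring_0"
  shows "coeff_sum (f * g) = coeff_sum f * coeff_sum g"
proof -
  have single: "coeff_sum (Poly_Mapping.single k v * g) = v * coeff_sum g"
    for k v and g :: "'a \<Rightarrow>\<^sub>0 'b"
    by (induction g rule: update_induct)
      (simp_all add: update_conv_add ring_distribs coeff_sum_add mult_single)
  show ?thesis
    by (induction f rule: update_induct)
      (simp_all add: update_conv_add ring_distribs coeff_sum_add single)
qed

lemma coeff_sum_uminus:
  fixes f :: "'a \<Rightarrow>\<^sub>0 'b::ab_group_add"
  shows "coeff_sum (- f) = - coeff_sum f"
  using coeff_sum_add[of f "- f"] by (simp add: eq_neg_iff_add_eq_0 add.commute)

lemma coeff_sum_diff: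
  fixes f :: "'a \<Rightarrow>\<^sub>0 'b::ab_group_add"
  shows "coeff_sum (f - g) = coeff_sum f - coeff_sum g"
  using coeff_sum_add[of f "- g"] by (simp add: coeff_sum_uminus)

lemma coeff_sum_1: "coeff_sum (1 :: 'a::monoid_add \<Rightarrow>\<^sub>0 'b::semiring_1) = 1"
  by (metis coeff_sum_single single_one)

lemma coeff_sum_power:
  fixes f :: "'a::monoid_add \<Rightarrow>\<^sub>0 'b::semiring_1"
  shows "coeff_sum (f ^ n) = coeff_sum f ^ n"
  by (induction n) (simp_all add: coeff_sum_mult coeff_sum_1)

lemma coeff_sum_hecke_rel: "coeff_sum (coeff_sum (hecke_rel g)) = - 3"
  by (simp add: hecke_rel_def Let_def coeff_sum_diff coeff_sum_add coeff_sum_mult coeff_sum_power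
      grp_elem_def grp_scalar_def coeff_sum_1 par_a_def par_b_def par_c_def par_d_def)

lemma coeff_sum_hecke_ideal: "x \<in> hecke_ideal \<Longrightarrow> 3 dvd coeff_sum (coeff_sum x)"
  unfolding hecke_ideal_def
  by (induction rule: two_sided_ideal.induct)
    (auto simp: coeff_sum_add coeff_sum_mult coeff_sum_hecke_rel)

lemma minus_one_notin_hecke_ideal: "- 1 \<notin> hecke_ideal"
  using coeff_sum_hecke_ideal[of "- 1"] by (auto simp: coeff_sum_1 coeff_sum_uminus)

instantiation H4 :: ring_1
begin

lift_definition zero_H4 :: H4 is 0 .

lift_definition one_H4 :: H4 is 1 .

lift_definition plus_H4 :: "H4 \<Rightarrow> H4 \<Rightarrow> H4" is "(+)"
  unfolding hecke_ideal_def by (drule (1) ideal_add) (simp add: algebra_simps)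

lift_definition uminus_H4 :: "H4 \<Rightarrow> H4" is uminus
  unfolding hecke_ideal_def by (drule ideal_uminus) simp

lift_definition minus_H4 :: "H4 \<Rightarrow> H4 \<Rightarrow> H4" is "(-)"
  unfolding hecke_ideal_def by (drule (1) ideal_diff) (simp add: algebra_simps)

lift_definition times_H4 :: "H4 \<Rightarrow> H4 \<Rightarrow> H4" is "(*)"
proof -
  fix x x' y y' :: R4B3
  assume "x - x' \<in> hecke_ideal" "y - y' \<in> hecke_ideal"
  then have "(x - x') * y + x' * (y - y') \<in> hecke_ideal"
    unfolding hecke_ideal_def by (intro ideal_add ideal_mult_left ideal_mult_right)
  then show "x * y - x' * y' \<in> hecke_ideal" by (simp add: algebra_simps)
qed

instance
proof
  have 0: "(0::R4B3) \<in> hecke_ideal" by (simp add: hecke_ideal_def ideal_0)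
  fix x y z :: H4
  show "x * y * z = x * (y * z)" by transfer (simp add: mult.assoc 0)
  show "1 * x = x" by transfer (simp add: 0)
  show "x * 1 = x" by transfer (simp add: 0)
  show "x + y + z = x + (y + z)" by transfer (simp add: add.assoc 0)
  show "x + y = y + x" by transfer (simp add: add.commute 0)
  show "0 + x = x" by transfer (simp add: 0)
  show "- x + x = 0" by transfer (simp add: 0)
  show "x - y = x + - y" by transfer (simp add: 0)
  show "(x + y) * z = x * z + y * z" by transfer (simp add: distrib_right 0)
  show "x * (y + z) = x * y + x * z" by transfer (simp add: distrib_left 0)
  show "(0::H4) \<noteq> 1"
    using minus_one_notin_hecke_ideal by transfer simp
qed

end

text \<open>The inverse of a unit; it is unspecified on non-units. Being an instance of
  \<^class>\<open>inverse\<close> makes the integer powers \<open>powi\<close> available.\<close>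

instantiation H4 :: inverse
begin

definition inverse_H4 :: "H4 \<Rightarrow> H4" where
  "inverse_H4 x = (THE y. x * y = 1 \<and> y * x = 1)"

definition divide_H4 :: "H4 \<Rightarrow> H4 \<Rightarrow> H4" where
  "divide_H4 x y = x * inverse y"

instance ..

end

lemma inverse_H4_eqI:
  fixes x y :: H4
  assumes "x * y = 1" "y * x = 1"
  shows "inverse x = y"
  unfolding inverse_H4_def
proof (rule the_equality)
  fix z assume z: "x * z = 1 \<and> z * x = 1"
  have "z = z * (x * y)" using assms by simp
  also have "\<dots> = (z * x) * y" by (simp only: mult.assoc)
  finally show "z = y" using z by simp
qed (use assms in simp)

lift_definition scale_H4 :: "R4 \<Rightarrow> H4 \<Rightarrow> H4" is "\<lambda>r x. grp_scalar r * x"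
  unfolding hecke_ideal_def by (simp add: ideal_mult_left flip: right_diff_distrib)

interpretation H4: module scale_H4
proof
  fix r r' :: R4 and x y :: H4
  obtain p q where x: "x = abs_H4 p" and y: "y = abs_H4 q"
    by (induct x rule: H4.abs_induct, induct y rule: H4.abs_induct) blast
  show "scale_H4 r (x + y) = scale_H4 r x + scale_H4 r y"
    by (simp add: x y scale_H4.abs_eq plus_H4.abs_eq distrib_left)
  show "scale_H4 (r + r') x = scale_H4 r x + scale_H4 r' x"
    by (simp add: x scale_H4.abs_eq plus_H4.abs_eq grp_scalar_add distrib_right)
  show "scale_H4 r (scale_H4 r' x) = scale_H4 (r * r') x"
    by (simp add: x scale_H4.abs_eq grp_scalar_mult mult.assoc)
  show "scale_H4 1 x = x"
    by (simp add: x scale_H4.abs_eq grp_scalar_1)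
qed

lift_definition of_braid :: "braid3 \<Rightarrow> H4" is grp_elem .

lemma of_braid_add: "of_braid (g + h) = of_braid g * of_braid h"
  by transfer (simp add: grp_elem_add hecke_ideal_def ideal_0)

lemma of_braid_0: "of_braid 0 = 1"
  by transfer (simp add: grp_elem_0 hecke_ideal_def ideal_0)

lemma of_braid_uminus: "of_braid (- g) = inverse (of_braid g)"
  by (rule inverse_H4_eqI[symmetric]) (simp_all add: of_braid_0 flip: of_braid_add)


section \<open>The submodules in question\<close>

definition s1 :: H4 where "s1 = of_braid (braid_gen Gen1)"
definition s2 :: H4 where "s2 = of_braid (braid_gen Gen2)"

definition subalgebra_H4 :: "H4 set \<Rightarrow> bool" where
  "subalgebra_H4 A \<longleftrightarrow> H4.subspace A \<and> 1 \<in> A \<and> (\<forall>x\<in>A. \<forall>y\<in>A. x * y \<in> A)"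

definition u1 :: "H4 set" where "u1 = subalgebra_H4 hull {s1}"
definition u2 :: "H4 set" where "u2 = subalgebra_H4 hull {s2}"

definition omega :: H4 (\<open>\<omega>\<close>) where "\<omega> = s2 * s1 ^ 2 * s2"

text \<open>The product of two subsets is the submodule spanned by the elementwise products, which
  is what \<open>X * Y\<close> denotes for sets; sums of submodules are elementwise.\<close>

definition span_prod :: "H4 set \<Rightarrow> H4 set \<Rightarrow> H4 set" (infixl \<open>\<cdot>\<close> 75) where
  "X \<cdot> Y = H4.span (X * Y)"

definition U :: "H4 set" where
  "U = u1 \<cdot> u2 \<cdot> u1
     + u1 \<cdot> {s2 * s1 powi -1 * s2} \<cdot> u1
     + u1 \<cdot> {s2 powi -1 * s1 * s2 powi -1} \<cdot> u1
     + u1 \<cdot> {s2 powi -1 * s1 powi -2 * s2 powi -1}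
     + u1 \<cdot> {s2 * s1 powi -2 * s2} \<cdot> u1
     + u1 \<cdot> {s2 powi -2 * s1 powi -2 * s2 powi -2} \<cdot> u1"

end

theory Submission
  imports Defs
begin

text \<open>Write \<open>tri i j k\<close> for \<open>s2\<^sup>i s1\<^sup>j s2\<^sup>k\<close> and let \<open>M\<close> be a \<open>u1\<close>-bimodule. Because \<open>d\<close> is invertible,
  \<open>M\<close> contains \<open>x t\<^sup>n y\<close> for all integers \<open>n\<close>, where \<open>t\<close> is a generator, as soon as it does so for four
  consecutive \<open>n\<close>. Moreover a braid word lies in \<open>M\<close> if and only if it does so after multiplication by
  powers of \<open>s1\<close> on both sides. These two rules alone, applied to the generators of the bimodule
  \<open>W\<close> on the right-hand side of (i), show that \<open>W s2\<close> is contained in \<open>W\<close>, so \<open>W\<close> is a right ideal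
  containing 1. The same rules show that \<open>U\<close> contains \<open>\<omega>\<close> and \<open>\<omega>\<^sup>-\<^sup>2\<close>, hence \<open>W\<close>.\<close>

section \<open>Powers of the generators\<close>

text \<open>The Garside element (half twist); conjugation by it interchanges \<open>s1\<close> and
  \<open>s2\<close>.\<close>

definition Delta :: H4 where "Delta = s1 * s2 * s1"

lemma of_braid_inverse:
  "of_braid g * inverse (of_braid g) = 1" "inverse (of_braid g) * of_braid g = 1"
  by (simp_all add: of_braid_0 flip: of_braid_uminus of_braid_add)

lemma s1_inverse: "s1 * inverse s1 = 1" "inverse s1 * s1 = 1"
  by (simp_all add: s1_def of_braid_inverse)

lemma s2_inverse: "s2 * inverse s2 = 1" "inverse s2 * s2 = 1"
  by (simp_all add: s2_def of_braid_inverse)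

lemma braid: "s1 * s2 * s1 = s2 * s1 * s2"
proof -
  have "braid_gen Gen1 + braid_gen Gen2 + braid_gen Gen1
      = braid_gen Gen2 + braid_gen Gen1 + braid_gen Gen2"
    by transfer (use braid_rel[of "[]" "[]"] in simp)
  then show ?thesis
    by (simp add: s1_def s2_def flip: of_braid_add)
qed

lemma Delta_inverse: "Delta * inverse Delta = 1" "inverse Delta * Delta = 1"
proof -
  have *: "Delta = of_braid (braid_gen Gen1 + braid_gen Gen2 + braid_gen Gen1)"
    by (simp add: Delta_def s1_def s2_def of_braid_add)
  show "Delta * inverse Delta = 1" "inverse Delta * Delta = 1"
    unfolding * by (simp_all only: of_braid_inverse)
qed

lemma Delta_s1: "s1 * Delta = Delta * s2"
proof -
  have "s1 * Delta = s1 * (s2 * s1 * s2)" by (simp only: Delta_def braid)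
  then show ?thesis by (simp only: Delta_def mult.assoc)
qed

lemma Delta_s2: "s2 * Delta = Delta * s1"
proof -
  have "s2 * Delta = s2 * s1 * s2 * s1" by (simp only: Delta_def mult.assoc)
  then show ?thesis by (simp only: Delta_def flip: braid)
qed

text \<open>Turns a rule moving \<open>Delta\<close> to the left into one moving
  \<open>inverse Delta\<close> to the left.\<close>

lemma inverse_commute:
  fixes x y z :: H4
  assumes "x * z = z * y" "z * inverse z = 1" "inverse z * z = 1"
  shows "y * inverse z = inverse z * x"
proof -
  have "y * inverse z = inverse z * (z * y) * inverse z"
    by (simp add: assms(3) flip: mult.assoc)
  also have "\<dots> = inverse z * (x * z) * inverse z"
    by (simp only: assms(1))
  also have "\<dots> = inverse z * x"
    by (simp add: mult.assoc assms(2))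
  finally show ?thesis .
qed

text \<open>Negative letters become \<open>inverse Delta\<close> times a positive word, so that only
  \<open>Delta\<close> still occurs inverted.\<close>

lemma inverse_s1: "inverse s1 = inverse Delta * (s1 * s2)"
proof -
  have "s1 * s2 = Delta * inverse s1"
    by (simp add: Delta_def mult.assoc s1_inverse)
  then show ?thesis
    by (simp add: Delta_inverse flip: mult.assoc)
qed

lemma inverse_s2: "inverse s2 = inverse Delta * (s2 * s1)"
proof -
  have "s2 * s1 = Delta * inverse s2"
    by (simp add: Delta_def braid) (simp add: mult.assoc s2_inverse)
  then show ?thesis
    by (simp add: Delta_inverse flip: mult.assoc)
qed

text \<open>Products are kept associated to the right, so each rewrite rule is needed also with a
  further factor behind its left-hand side.\<close>

lemma assoc_rule: "x * y = z \<Longrightarrow> x * (y * w) = z * w" for x y z w :: H4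
  by (simp flip: mult.assoc)

lemma assoc_rule3: "x * (y * z) = v \<Longrightarrow> x * (y * (z * w)) = v * w" for x y z v w :: H4
  by (simp flip: mult.assoc)

lemma s1_s2_s1: "s1 * (s2 * s1) = Delta" and s2_s1_s2: "s2 * (s1 * s2) = Delta"
  using braid by (simp_all add: Delta_def mult.assoc)

text \<open>Together with associativity these rules bring every word in the generators and their
  inverses into Garside normal form, so they decide equality in the braid group.\<close>

lemmas garside_nf =
  inverse_s1 inverse_s2 mult.assoc
  s1_s2_s1 s2_s1_s2 s1_s2_s1[THEN assoc_rule3] s2_s1_s2[THEN assoc_rule3]
  Delta_s1 Delta_s2 Delta_s1[THEN assoc_rule] Delta_s2[THEN assoc_rule]
  inverse_commute[OF Delta_s1 Delta_inverse] inverse_commute[OF Delta_s2 Delta_inverse]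
  inverse_commute[OF Delta_s1 Delta_inverse, THEN assoc_rule]
  inverse_commute[OF Delta_s2 Delta_inverse, THEN assoc_rule]
  Delta_inverse Delta_inverse[THEN assoc_rule]

lemma powi_unit_Suc:
  fixes t :: H4
  assumes "t * inverse t = 1" "inverse t * t = 1"
  shows "t powi (k + 1) = t powi k * t"
proof (cases "k \<ge> 0")
  case True
  then have "nat (k + 1) = Suc (nat k)" by simp
  with True show ?thesis
    by (simp add: power_int_def power_commutes)
next
  case False
  then obtain n where n: "k = - int (Suc n)"
    using negD[of k] by auto
  have "t powi (k + 1) = inverse t ^ n"
    using n by (cases "n = 0") (auto simp: power_int_def)
  moreover have "t powi k = inverse t ^ Suc n"
    using n by (simp add: power_int_def nat_add_distrib)
  moreover have "inverse t ^ Suc n * t = inverse t ^ n"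
    by (simp only: power_Suc2 mult.assoc assms mult_1_right)
  ultimately show ?thesis
    by simp
qed

lemmas s2_powi_Suc = powi_unit_Suc[OF s2_inverse]

text \<open>Cancelling \<open>x\<close> and \<open>y\<close> gives
  \<open>z * inverse x = inverse y * z\<close>, which extends the relation to negative
  exponents.\<close>

lemma intertwine_powi:
  fixes x y z :: H4
  assumes comm: "z * x = y * z"
    and x: "x * inverse x = 1" "inverse x * x = 1"
    and y: "y * inverse y = 1" "inverse y * y = 1"
  shows "z * x powi k = y powi k * z"
proof -
  have *: "z * x ^ n = y ^ n * z" if "z * x = y * z" for x y :: H4 and n
  proof (induction n)
    case (Suc n)
    have "z * x ^ Suc n = z * x * x ^ n" by (simp add: mult.assoc)
    also have "\<dots> = y * (z * x ^ n)" by (simp add: that mult.assoc)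
    finally show ?case by (simp add: Suc mult.assoc)
  qed simp
  have "z * inverse x = inverse y * (y * z) * inverse x"
    by (simp add: y flip: mult.assoc)
  also have "\<dots> = inverse y * (z * x) * inverse x"
    by (simp only: comm)
  also have "\<dots> = inverse y * z"
    by (simp add: mult.assoc x)
  finally show ?thesis
    using * comm by (simp add: power_int_def)
qed

lemma s2_powi_add: "s2 powi (m + n) = s2 powi m * s2 powi n"
proof (induction n rule: int_induct[where k = 0])
  case (step1 n)
  then show ?case
    by (simp add: s2_powi_Suc mult.assoc flip: add.assoc)
next
  case (step2 n)
  have "s2 powi (m + (n - 1)) = s2 powi (m + n) * inverse s2"
    using s2_powi_Suc[of "m + n - 1"] by (simp add: mult.assoc s2_inverse algebra_simps)
  moreover have "s2 powi (n - 1) = s2 powi n * inverse s2"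
    using s2_powi_Suc[of "n - 1"] by (simp add: mult.assoc s2_inverse)
  ultimately show ?case
    using step2 by (simp add: mult.assoc)
qed simp


section \<open>The quartic relation\<close>

lemma abs_H4_power: "abs_H4 x ^ n = abs_H4 (x ^ n)"
  by (induction n) (simp_all add: one_H4_def times_H4.abs_eq)

lemma abs_H4_scalar_mult: "abs_H4 (grp_scalar r * x) = scale_H4 r (abs_H4 x)"
  by (simp add: scale_H4.abs_eq)

lemma quartic_relation:
  "of_braid (braid_gen g) ^ 4 = scale_H4 par_a (of_braid (braid_gen g) ^ 3)
     + scale_H4 par_b (of_braid (braid_gen g) ^ 2) + scale_H4 par_c (of_braid (braid_gen g))
     + scale_H4 par_d 1"
proof -
  define s where "s = grp_elem (braid_gen g)"
  have "hecke_rel g \<in> hecke_ideal"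
    using ideal_gen[of "hecke_rel g" "range hecke_rel" 1 1] by (simp add: hecke_ideal_def)
  \<comment> \<open>The constant term gets a factor 1 so that \<open>abs_H4_scalar_mult\<close>
    applies to it as well.\<close>
  then have "abs_H4 (s ^ 4) = abs_H4 (grp_scalar par_a * s ^ 3 + grp_scalar par_b * s ^ 2
      + grp_scalar par_c * s + grp_scalar par_d * 1)"
    by (simp add: H4.abs_eq_iff hecke_rel_def s_def Let_def)
  moreover have "of_braid (braid_gen g) = abs_H4 s"
    by (simp add: of_braid.abs_eq s_def)
  moreover have "abs_H4 1 = 1"
    by (simp add: one_H4_def)
  ultimately show ?thesis
    by (simp only: abs_H4_power abs_H4_scalar_mult plus_H4.abs_eq[symmetric])
qed

text \<open>The coefficients commute and \<open>grp_scalar r\<close> sits at the neutral braid.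
  Centrality lets scalars pass either factor of a product in \<open>H4\<close>.\<close>

lemma grp_scalar_commute: "grp_scalar r * x = x * grp_scalar r"
  by (induction x rule: update_induct)
    (simp_all add: update_conv_add ring_distribs grp_scalar_def mult_single mult.commute)

lemma scale_H4_mult_left: "scale_H4 r x * y = scale_H4 r (x * y)"
  by (induct x rule: H4.abs_induct, induct y rule: H4.abs_induct)
    (simp add: scale_H4.abs_eq times_H4.abs_eq mult.assoc)

lemma scale_H4_mult_right: "x * scale_H4 r y = scale_H4 r (x * y)"
proof -
  have "p * (grp_scalar r * q) = grp_scalar r * (p * q)" for p q
    by (simp add: grp_scalar_commute[of r p] flip: mult.assoc)
  then show ?thesis
    by (induct x rule: H4.abs_induct, induct y rule: H4.abs_induct)
      (simp add: scale_H4.abs_eq times_H4.abs_eq)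
qed

text \<open>The monomial is the inverse of \<open>par_d\<close>; this is where the invertibility of
  \<open>d\<close> enters.\<close>

lemma scale_par_d_cancel: "scale_H4 (Poly_Mapping.single (0, 0, 0, - 1) 1) (scale_H4 par_d x) = x"
proof -
  have "Poly_Mapping.single (0, 0, 0, - 1) 1 * par_d = (1 :: R4)"
    by (simp add: par_d_def mult_single flip: zero_prod_def)
  then show ?thesis by simp
qed

text \<open>Since \<open>d\<close> is a unit, the quartic relation expresses either of the two outer ones among
  five consecutive powers of a generator by the other four.\<close>

lemma four_consecutive_powers:
  assumes K: "H4.subspace K"
    and "x * of_braid (braid_gen g) powi m * y \<in> K"
    and "x * of_braid (braid_gen g) powi (m + 1) * y \<in> K"
    and "x * of_braid (braid_gen g) powi (m + 2) * y \<in> K"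
    and "x * of_braid (braid_gen g) powi (m + 3) * y \<in> K"
  shows "x * of_braid (braid_gen g) powi n * y \<in> K"
proof -
  define t where "t = of_braid (braid_gen g)"
  define f where "f k = x * t powi k * y" for k
  have Suc: "t powi (k + 1) = t powi k * t" for k
    by (simp add: powi_unit_Suc t_def of_braid_inverse)
  have pow: "t powi (k + 2) = t powi k * t ^ 2" "t powi (k + 3) = t powi k * t ^ 3"
      "t powi (k + 4) = t powi k * t ^ 4" for k
  proof -
    have "k + 2 = k + 1 + 1" "k + 3 = k + 1 + 1 + 1" "k + 4 = k + 1 + 1 + 1 + 1" by simp_all
    then show "t powi (k + 2) = t powi k * t ^ 2" "t powi (k + 3) = t powi k * t ^ 3"
      "t powi (k + 4) = t powi k * t ^ 4"
      by (simp_all only: Suc) (simp_all add: eval_nat_numeral mult.assoc)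
  qed
  have quartic: "f (k + 4) = scale_H4 par_a (f (k + 3)) + scale_H4 par_b (f (k + 2))
      + scale_H4 par_c (f (k + 1)) + scale_H4 par_d (f k)" for k
    by (simp add: f_def pow Suc quartic_relation[of g, folded t_def] distrib_left distrib_right
        scale_H4_mult_left scale_H4_mult_right mult.assoc)
  note closed = H4.subspace_add[OF K] H4.subspace_scale[OF K] H4.subspace_diff[OF K]
  \<comment> \<open>A window of four consecutive exponents, which the quartic relation shifts by one
    in either direction.\<close>
  define P where "P k \<longleftrightarrow> f k \<in> K \<and> f (k + 1) \<in> K \<and> f (k + 2) \<in> K \<and> f (k + 3) \<in> K" for k
  have up: "P (k + 1)" if "P k" for k
    using that quartic[of k] by (simp add: P_def closed add.assoc)
  have down: "P (k - 1)" if "P k" for k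
  proof -
    have "scale_H4 par_d (f (k - 1)) = f (k + 3) - scale_H4 par_a (f (k + 2))
        - scale_H4 par_b (f (k + 1)) - scale_H4 par_c (f k)"
      using quartic[of "k - 1"] by (simp add: algebra_simps)
    then have "scale_H4 par_d (f (k - 1)) \<in> K"
      using that by (simp add: P_def closed)
    then have "f (k - 1) \<in> K"
      using closed(2) scale_par_d_cancel by metis
    then show ?thesis
      using that by (simp add: P_def algebra_simps)
  qed
  have "P m"
    using assms by (simp add: P_def f_def t_def)
  then have "P n"
    by (induction n rule: int_induct[where k = m]) (simp_all add: up down)
  then show ?thesis
    by (simp add: P_def f_def t_def)
qed

lemmas four_s1_powers = four_consecutive_powers[of _ _ Gen1, folded s1_def]
lemmas four_s2_powers = four_consecutive_powers[of _ _ Gen2, folded s2_def]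


section \<open>Generated subalgebras and spans\<close>

text \<open>Lets \<open>H4.span_minimal\<close> show that a multiplication maps a span into
  \<open>K\<close> by checking the spanning set alone.\<close>

lemma H4_subspace_mult_preimage:
  assumes "H4.subspace K"
  shows "H4.subspace {x. p * x * q \<in> K}"
  using assms
  by (auto simp: H4.subspace_def distrib_left distrib_right scale_H4_mult_left scale_H4_mult_right)

lemmas H4_subspace_mult_left_preimage = H4_subspace_mult_preimage[of _ _ 1, simplified]
lemmas H4_subspace_mult_right_preimage = H4_subspace_mult_preimage[of _ 1, simplified]

lemma subalgebra_H4_hull: "subalgebra_H4 (subalgebra_H4 hull S)"
  by (rule hull_in) (auto simp: subalgebra_H4_def H4.subspace_def)

text \<open>The powers of \<open>t\<close> span a subalgebra, as bilinearity reduces closure under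
  products to products of powers; hence the hull lies in that span.\<close>

lemma subalgebra_H4_hull_singleton_induct:
  assumes p: "p \<in> subalgebra_H4 hull {t}" and K: "H4.subspace K" and pow: "\<And>n. t ^ n \<in> K"
  shows "p \<in> K"
proof -
  let ?S = "H4.span (range (\<lambda>n. t ^ n))"
  have "x * y \<in> ?S" if "x \<in> ?S" "y \<in> ?S" for x y
  proof -
    have "t ^ m * y \<in> ?S" for m
    proof -
      have "?S \<subseteq> {y. t ^ m * y \<in> ?S}"
        by (intro H4.span_minimal H4_subspace_mult_left_preimage H4.subspace_span)
          (auto intro!: H4.span_base simp flip: power_add)
      then show ?thesis using that by auto
    qed
    then have "?S \<subseteq> {x. x * y \<in> ?S}"
      by (intro H4.span_minimal H4_subspace_mult_right_preimage H4.subspace_span) auto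
    then show ?thesis using that by auto
  qed
  moreover have "t ^ n \<in> ?S" for n
    by (simp add: H4.span_base)
  from this[of 0] this[of 1] have "1 \<in> ?S" "t \<in> ?S" by simp_all
  ultimately have "subalgebra_H4 hull {t} \<subseteq> ?S"
    by (intro hull_minimal) (auto simp: subalgebra_H4_def)
  also have "?S \<subseteq> K"
    using K pow by (intro H4.span_minimal) auto
  finally show ?thesis using p by blast
qed

lemma u1_induct [consumes 1, case_names subspace powi]:
  assumes "p \<in> u1" "H4.subspace K" "\<And>k. s1 powi k \<in> K"
  shows "p \<in> K"
  using assms(1,2) assms(3)[of "int _"]
  by (auto simp: u1_def intro: subalgebra_H4_hull_singleton_induct)

lemma u2_induct [consumes 1, case_names subspace powi]:
  assumes "p \<in> u2" "H4.subspace K" "\<And>k. s2 powi k \<in> K"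
  shows "p \<in> K"
  using assms(1,2) assms(3)[of "int _"]
  by (auto simp: u2_def intro: subalgebra_H4_hull_singleton_induct)

lemma subalgebra_power: "subalgebra_H4 A \<Longrightarrow> x \<in> A \<Longrightarrow> x ^ n \<in> A"
  by (induction n) (auto simp: subalgebra_H4_def)

lemma s1_powi_in_u1: "s1 powi k \<in> u1"
proof -
  have "subalgebra_H4 u1" "s1 \<in> u1"
    by (auto simp: u1_def subalgebra_H4_hull hull_inc)
  then have "s1 ^ n \<in> u1" "H4.subspace u1" for n
    using subalgebra_power by (auto simp: subalgebra_H4_def)
  from this(1)[of 0] this(1)[of 1] this(1)[of 2] this(1)[of 3] this(2) show ?thesis
    using four_s1_powers[of u1 1 0 1 k] by simp
qed

lemma s2_powi_in_u2: "s2 powi k \<in> u2"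
proof -
  have "subalgebra_H4 u2" "s2 \<in> u2"
    by (auto simp: u2_def subalgebra_H4_hull hull_inc)
  then have "s2 ^ n \<in> u2" "H4.subspace u2" for n
    using subalgebra_power by (auto simp: subalgebra_H4_def)
  from this(1)[of 0] this(1)[of 1] this(1)[of 2] this(1)[of 3] this(2) show ?thesis
    using four_s2_powers[of u2 1 0 1 k] by simp
qed

lemma span_prod_intro: "x \<in> X \<Longrightarrow> y \<in> Y \<Longrightarrow> x * y \<in> X \<cdot> Y"
  by (auto simp: span_prod_def intro: H4.span_base)

lemma span_prod_minimal:
  assumes "H4.subspace K" "\<And>x y. x \<in> X \<Longrightarrow> y \<in> Y \<Longrightarrow> x * y \<in> K"
  shows "X \<cdot> Y \<subseteq> K"
  unfolding span_prod_def using assms by (intro H4.span_minimal) (auto elim: set_times_elim)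

lemma subspace_span_prod: "H4.subspace (X \<cdot> Y)"
  by (simp add: span_prod_def)


section \<open>Bimodules over the first subalgebra\<close>

locale u1_bimodule =
  fixes M :: "H4 set"
  assumes subspace: "H4.subspace M"
    and left: "p \<in> u1 \<Longrightarrow> x \<in> M \<Longrightarrow> p * x \<in> M"
    and right: "p \<in> u1 \<Longrightarrow> x \<in> M \<Longrightarrow> x * p \<in> M"

lemma mult_closed_u1: "p \<in> u1 \<Longrightarrow> q \<in> u1 \<Longrightarrow> p * q \<in> u1"
  using subalgebra_H4_hull[of "{s1}"] by (auto simp: u1_def subalgebra_H4_def)

lemma span_prod_closed_left:
  assumes "\<And>x. x \<in> X \<Longrightarrow> p * x \<in> X" "z \<in> X \<cdot> Y"
  shows "p * z \<in> X \<cdot> Y"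
proof -
  have "X \<cdot> Y \<subseteq> {z. p * z \<in> X \<cdot> Y}"
    using assms(1) by (intro span_prod_minimal H4_subspace_mult_left_preimage subspace_span_prod)
      (auto intro: span_prod_intro simp flip: mult.assoc)
  then show ?thesis using assms(2) by auto
qed

lemma span_prod_closed_right:
  assumes "\<And>y. y \<in> Y \<Longrightarrow> y * p \<in> Y" "z \<in> X \<cdot> Y"
  shows "z * p \<in> X \<cdot> Y"
proof -
  have "X \<cdot> Y \<subseteq> {z. z * p \<in> X \<cdot> Y}"
    using assms(1) by (intro span_prod_minimal H4_subspace_mult_right_preimage subspace_span_prod)
      (auto intro: span_prod_intro simp: mult.assoc)
  then show ?thesis using assms(2) by auto
qed

lemma u1_bimodule_span_prod: "u1_bimodule (u1 \<cdot> X \<cdot> u1)"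
  by unfold_locales
    (auto intro: span_prod_closed_left span_prod_closed_right subspace_span_prod mult_closed_u1)

text \<open>Here \<open>x\<close> commutes with all of \<open>u1\<close>, so right factors can be
  moved to the left. This is why the summands built from powers of \<open>\<omega>\<close> carry no
  right factor \<open>u1\<close>.\<close>

lemma u1_bimodule_span_prod_commuting:
  assumes "x * s1 = s1 * x"
  shows "u1_bimodule (u1 \<cdot> {x})"
proof
  have comm: "x * p = p * x" if "p \<in> u1" for p
  proof -
    have "p \<in> {p. x * p = p * x}"
      using that
    proof (induction rule: u1_induct)
      case subspace
      show ?case
        by (auto simp: H4.subspace_def distrib_left distrib_right scale_H4_mult_left scale_H4_mult_right)
    next
      case (powi k)
      show ?case
        using intertwine_powi[OF assms s1_inverse s1_inverse] by simp
    qed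
    then show ?thesis by simp
  qed
  fix p z assume p: "p \<in> u1" and z: "z \<in> u1 \<cdot> {x}"
  show "p * z \<in> u1 \<cdot> {x}"
    using p z by (auto intro: span_prod_closed_left mult_closed_u1)
  have "q * x * p \<in> u1 \<cdot> {x}" if "q \<in> u1" for q
  proof -
    have "q * x * p = q * p * x"
      using comm[OF p] by (simp add: mult.assoc)
    then show ?thesis
      using that p by (simp add: span_prod_intro mult_closed_u1)
  qed
  then have "u1 \<cdot> {x} \<subseteq> {z. z * p \<in> u1 \<cdot> {x}}"
    by (intro span_prod_minimal H4_subspace_mult_right_preimage subspace_span_prod) auto
  then show "z * p \<in> u1 \<cdot> {x}" using z by auto
qed (rule subspace_span_prod)

lemma u1_bimodule_plus:
  assumes "u1_bimodule A" "u1_bimodule B"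
  shows "u1_bimodule (A + B)"
proof -
  interpret A: u1_bimodule A by fact
  interpret B: u1_bimodule B by fact
  show ?thesis
  proof
    show "H4.subspace (A + B)"
    proof (rule H4.subspaceI)
      show "0 \<in> A + B"
        using set_plus_intro[OF H4.subspace_0[OF A.subspace] H4.subspace_0[OF B.subspace]] by simp
      show "x + y \<in> A + B" if x: "x \<in> A + B" and y: "y \<in> A + B" for x y
      proof -
        obtain a b where "x = a + b" "a \<in> A" "b \<in> B"
          using x by (rule set_plus_elim)
        moreover obtain a' b' where "y = a' + b'" "a' \<in> A" "b' \<in> B"
          using y by (rule set_plus_elim)
        ultimately show ?thesis
          using set_plus_intro[OF H4.subspace_add[OF A.subspace] H4.subspace_add[OF B.subspace],
              of a a' b b'] by (simp add: algebra_simps)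
      qed
      show "scale_H4 r x \<in> A + B" if "x \<in> A + B" for r x
        using that by (auto elim!: set_plus_elim simp: H4.scale_right_distrib
            intro!: set_plus_intro H4.subspace_scale[OF A.subspace] H4.subspace_scale[OF B.subspace])
    qed
  qed (auto elim!: set_plus_elim simp: distrib_left distrib_right
      intro!: set_plus_intro intro: A.left A.right B.left B.right)
qed


text \<open>In the names below, \<open>p\<close>, \<open>m\<close> and \<open>x\<close> stand for the exponents \<open>1\<close>, \<open>-1\<close> and an arbitrary one;
  \<open>p2\<close> and \<open>m2\<close> for \<open>2\<close> and \<open>-2\<close>.\<close>

definition tri :: "int \<Rightarrow> int \<Rightarrow> int \<Rightarrow> H4" where
  "tri i j k = s2 powi i * s1 powi j * s2 powi k"

lemma tri_zero_middle: "tri i 0 k = s2 powi (i + k)"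
  by (simp add: tri_def s2_powi_add)

text \<open>Conjugation by \<open>s1 * s2\<close> carries \<open>s1\<close> to \<open>s2\<close>,
  hence every power of \<open>s1\<close> to the same power of \<open>s2\<close>.\<close>

lemma tri_1_minus_1: "tri 1 k (- 1) = s1 powi - 1 * s2 powi k * s1 powi 1"
proof -
  have "s1 * s2 * s1 powi k = s2 powi k * (s1 * s2)"
    by (rule intertwine_powi[OF _ s1_inverse s2_inverse]) (simp add: garside_nf)
  then have "inverse s1 * (s1 * s2 * s1 powi k) * inverse s2
      = inverse s1 * (s2 powi k * (s1 * s2)) * inverse s2" by simp
  then show ?thesis
    by (simp add: tri_def power_int_def[of _ "- 1"] mult.assoc s2_inverse s1_inverse[THEN assoc_rule])
qed

text \<open>The preceding identity with \<open>s1\<close> and \<open>s2\<close> interchanged, read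
  from right to left.\<close>

lemma tri_minus_1_1: "tri (- 1) k 1 = s1 powi 1 * s2 powi k * s1 powi - 1"
proof -
  have "s2 * s1 * s2 powi k = s1 powi k * (s2 * s1)"
    by (rule intertwine_powi[OF _ s2_inverse s1_inverse]) (simp add: garside_nf)
  then have "inverse s2 * (s2 * s1 * s2 powi k) * inverse s1
      = inverse s2 * (s1 powi k * (s2 * s1)) * inverse s1" by simp
  then show ?thesis
    by (simp add: tri_def power_int_def[of _ "- 1"] mult.assoc s1_inverse s2_inverse[THEN assoc_rule])
qed

lemmas word_nf = tri_def power_int_def power2_eq_square power3_eq_cube garside_nf

section \<open>The element \<open>\<omega>\<close> and its inverse\<close>

lemma omega_inverse: "inverse \<omega> = tri (- 1) (- 2) (- 1)"
  by (rule inverse_H4_eqI) (simp_all add: omega_def word_nf)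

lemma omega_tri: "\<omega> = tri 1 2 1"
  by (simp add: omega_def word_nf)

text \<open>Behind this is \<open>s1 * \<omega> * s1 = Delta ^ 2\<close>, which is central, so
  \<open>\<omega>\<close> is a central element times a power of \<open>s1\<close>.\<close>

lemma omega_commute: "\<omega> * s1 = s1 * \<omega>"
  by (simp add: omega_def word_nf)

lemma inverse_omega_commute: "inverse \<omega> * s1 = s1 * inverse \<omega>"
  by (simp add: omega_inverse word_nf)

lemma inverse_omega_square_commute: "(inverse \<omega>)\<^sup>2 * s1 = s1 * (inverse \<omega>)\<^sup>2"
  by (simp add: power2_eq_square mult.assoc inverse_omega_commute
      inverse_omega_commute[THEN assoc_rule])

context u1_bimodule
begin

text \<open>The rule on multiplication by powers of \<open>s1\<close>; its equation will be an
  identity of braids. The next three lemmas are the rule on four consecutive powers, one for each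
  exponent of \<open>tri\<close>.\<close>

lemma u1_multiple:
  assumes "s1 powi i * x * s1 powi j = y" "x \<in> M"
  shows "y \<in> M"
  using assms left right s1_powi_in_u1 by metis

lemma tri_first:
  assumes "tri m j k \<in> M" "tri (m + 1) j k \<in> M" "tri (m + 2) j k \<in> M" "tri (m + 3) j k \<in> M"
  shows "tri n j k \<in> M"
  using four_s2_powers[OF subspace, of 1 m "s1 powi j * s2 powi k" n] assms
  by (simp add: tri_def mult.assoc)

lemma tri_middle:
  assumes "tri i m k \<in> M" "tri i (m + 1) k \<in> M" "tri i (m + 2) k \<in> M" "tri i (m + 3) k \<in> M"
  shows "tri i n k \<in> M"
  using four_s1_powers[OF subspace, of "s2 powi i" m "s2 powi k" n] assms
  by (simp add: tri_def mult.assoc)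

lemma tri_last:
  assumes "tri i j m \<in> M" "tri i j (m + 1) \<in> M" "tri i j (m + 2) \<in> M" "tri i j (m + 3) \<in> M"
  shows "tri i j n \<in> M"
  using four_s2_powers[OF subspace, of "s2 powi i * s1 powi j" m 1 n] assms
  by (simp add: tri_def mult.assoc)

end

section \<open>Words lying in both sides of (i)\<close>

locale u1_bimodule_words = u1_bimodule +
  assumes u2_powers: "s2 powi k \<in> M"
    and tri_pmp: "tri 1 (- 1) 1 \<in> M"
    and tri_mpm: "tri (- 1) 1 (- 1) \<in> M"
    and inverse_omega: "tri (- 1) (- 2) (- 1) \<in> M"
begin

lemma tri_zero_first: "tri 0 j k \<in> M"
  by (rule u1_multiple[of j "s2 powi k" 0]) (simp_all add: tri_def u2_powers)

lemma tri_zero_last: "tri i j 0 \<in> M"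
  by (rule u1_multiple[of 0 "s2 powi i" j]) (simp_all add: tri_def u2_powers)

lemma tri_zero_middle_mem: "tri i 0 k \<in> M"
  by (simp add: tri_zero_middle u2_powers)

lemma tri_p_m: "tri 1 k (- 1) \<in> M"
  by (rule u1_multiple[of "- 1" "s2 powi k" 1]) (simp_all add: tri_1_minus_1 u2_powers)

lemma tri_m_p: "tri (- 1) k 1 \<in> M"
  by (rule u1_multiple[of 1 "s2 powi k" "- 1"]) (simp_all add: tri_minus_1_1 u2_powers)

lemmas tri_trivial = tri_zero_first tri_zero_last tri_zero_middle_mem tri_p_m tri_m_p

text \<open>The first exponents -1, 0 and 1 are known, and -2 comes from \<open>tri_mpm\<close>. The
  next three lemmas repeat this for the reversed word and for opposite signs.\<close>

lemma tri_x_m_p: "tri k (- 1) 1 \<in> M"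
proof (rule tri_first[of "- 2", simplified])
  show "tri (- 2) (- 1) 1 \<in> M"
    by (rule u1_multiple[OF _ tri_mpm, of 0 "- 1"]) (simp add: word_nf)
qed (simp_all add: tri_trivial tri_pmp)

lemma tri_p_m_x: "tri 1 (- 1) k \<in> M"
proof (rule tri_last[of _ _ "- 2", simplified])
  show "tri 1 (- 1) (- 2) \<in> M"
    by (rule u1_multiple[OF _ tri_mpm, of "- 1" 0]) (simp add: word_nf)
qed (simp_all add: tri_trivial tri_pmp)

lemma tri_x_p_m: "tri k 1 (- 1) \<in> M"
proof (rule tri_first[of "- 1", simplified])
  show "tri 2 1 (- 1) \<in> M"
    by (rule u1_multiple[OF _ tri_pmp, of 0 1]) (simp add: word_nf)
qed (simp_all add: tri_trivial tri_mpm)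

lemma tri_m_p_x: "tri (- 1) 1 k \<in> M"
proof (rule tri_last[of _ _ "- 1", simplified])
  show "tri (- 1) 1 2 \<in> M"
    by (rule u1_multiple[OF _ tri_pmp, of 1 0]) (simp add: word_nf)
qed (simp_all add: tri_trivial tri_mpm)

text \<open>The middle exponents -2 and 1 are assumptions, 0 gives a power of \<open>s2\<close>, and
  -1 is the inverted braid relation.\<close>

lemma tri_m_x_m: "tri (- 1) k (- 1) \<in> M"
proof (rule tri_middle[of _ "- 2", simplified])
  show "tri (- 1) (- 1) (- 1) \<in> M"
    by (rule u1_multiple[OF _ u2_powers[of "- 1"], of "- 1" "- 1"]) (simp add: word_nf)
qed (simp_all add: tri_trivial tri_mpm inverse_omega)

lemma tri_x_m2_m: "tri k (- 2) (- 1) \<in> M"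
proof (rule tri_first[of "- 2", simplified])
  show "tri (- 2) (- 2) (- 1) \<in> M"
    by (rule u1_multiple[OF _ tri_m_x_m[of "- 3"], of "- 1" 1]) (simp add: word_nf)
qed (simp_all add: tri_trivial inverse_omega)

lemma tri_m2_x_m: "tri (- 2) k (- 1) \<in> M"
proof (rule tri_middle[of _ "- 2", simplified])
  show "tri (- 2) (- 1) (- 1) \<in> M"
    by (rule u1_multiple[OF _ u2_powers[of "- 1"], of "- 1" "- 2"]) (simp add: word_nf)
qed (simp_all add: tri_trivial tri_x_m2_m tri_x_p_m)

text \<open>Exchanges the generators of the last summands on the two sides of (i).\<close>

lemma inverse_omega_square_iff: "(inverse \<omega>)\<^sup>2 \<in> M \<longleftrightarrow> tri (- 2) (- 2) (- 2) \<in> M"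
proof -
  \<comment> \<open>The square of \<open>inverse \<omega>\<close> is \<open>f (- 2)\<close>, while
    \<open>f 2\<close> is \<open>tri (- 2) (- 2) (- 2)\<close> times \<open>s1 powi 2\<close>. The
    three values in between lie in \<open>M\<close>, so four consecutive powers link the two
    ends.\<close>
  define f where "f k = s2 powi - 1 * s1 powi k * tri (- 2) (- 2) (- 1)" for k
  have line: "f n \<in> M" if "f m \<in> M" "f (m + 1) \<in> M" "f (m + 2) \<in> M" "f (m + 3) \<in> M" for m n
    using four_s1_powers[OF subspace, of "s2 powi - 1" m _ n] that by (simp add: f_def)
  have minus_1: "f (- 1) \<in> M"
    by (rule u1_multiple[OF _ tri_x_m2_m[of "- 2"], of "- 1" "- 1"]) (simp add: f_def word_nf)
  have zero: "f 0 \<in> M"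
    by (rule u1_multiple[OF _ tri_x_m2_m[of "- 3"], of 0 0]) (simp add: f_def word_nf)
  have one: "f 1 \<in> M"
    by (rule u1_multiple[OF _ tri_m2_x_m[of "- 3"], of 0 1]) (simp add: f_def word_nf)
  have "(inverse \<omega>)\<^sup>2 = f (- 2)"
    by (simp add: f_def omega_inverse word_nf)
  moreover have "f (- 2) \<in> M \<longleftrightarrow> f 2 \<in> M"
    using line[of "- 2" 2] line[of "- 1" "- 2"] minus_1 zero one by auto
  moreover have "f 2 \<in> M \<longleftrightarrow> tri (- 2) (- 2) (- 2) \<in> M"
  proof
    show "tri (- 2) (- 2) (- 2) \<in> M" if "f 2 \<in> M"
      by (rule u1_multiple[OF _ that, of 0 "- 2"]) (simp add: f_def word_nf)
    show "f 2 \<in> M" if "tri (- 2) (- 2) (- 2) \<in> M"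
      by (rule u1_multiple[OF _ that, of 0 2]) (simp add: f_def word_nf)
  qed
  ultimately show ?thesis by simp
qed

lemma tri_p_p: "tri 1 1 1 \<in> M"
  by (rule u1_multiple[OF _ u2_powers[of 1], of 1 1]) (simp add: word_nf)

text \<open>The same exchange for \<open>\<omega>\<close>: the middle exponents -1, 0 and 1 give
  elements of \<open>M\<close>, so 2 and -2 are equivalent.\<close>

lemma omega_iff: "\<omega> \<in> M \<longleftrightarrow> tri 1 (- 2) 1 \<in> M"
proof -
  have "tri 1 2 1 \<in> M \<longleftrightarrow> tri 1 (- 2) 1 \<in> M"
    using tri_middle[of 1 "- 1" 1 "- 2", simplified] tri_middle[of 1 "- 2" 1 2, simplified]
      tri_p_p tri_pmp by (auto simp: tri_trivial)
  then show ?thesis by (simp only: omega_tri)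
qed

end

section \<open>Right multiplication by \<open>s2\<close> on the right-hand side of (i)\<close>

locale u1_bimodule_omega = u1_bimodule_words +
  assumes omega: "\<omega> \<in> M"
    and inverse_omega_square: "(inverse \<omega>)\<^sup>2 \<in> M"
begin

lemma tri_p_x_p: "tri 1 k 1 \<in> M"
  by (rule tri_middle[of _ "- 1", simplified])
    (use tri_pmp tri_p_p omega in \<open>simp_all add: tri_trivial omega_tri\<close>)

lemma tri_m2_m2_x: "tri (- 2) (- 2) k \<in> M"
proof (rule tri_last[of _ _ "- 2", simplified])
  show "tri (- 2) (- 2) (- 2) \<in> M"
    using inverse_omega_square inverse_omega_square_iff by simp
  show "tri (- 2) (- 2) 1 \<in> M"
    by (rule u1_multiple[OF _ tri_m_p_x[of "- 2"], of 0 "- 1"]) (simp add: word_nf)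
qed (simp_all add: tri_trivial tri_x_m2_m)

lemma tri_m2_x_p2: "tri (- 2) k 2 \<in> M"
proof (rule tri_middle[of _ "- 2", simplified])
  show "tri (- 2) (- 1) 2 \<in> M"
    by (rule u1_multiple[OF _ tri_m_x_m[of 2], of 0 "- 1"]) (simp add: word_nf)
  show "tri (- 2) 1 2 \<in> M"
    by (rule u1_multiple[OF _ tri_p_x_p[of "- 2"], of 1 0]) (simp add: word_nf)
qed (simp_all add: tri_trivial tri_m2_m2_x)

text \<open>Up to linearity and left factors from \<open>u1\<close>, these are the products of the
  summand \<open>u1 \<cdot> u2 \<cdot> u1\<close> with \<open>s2\<close>.\<close>

lemma tri_x_x_p: "tri n k 1 \<in> M"
proof (rule tri_first[of "- 1", simplified])
  show "tri 2 k 1 \<in> M"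
  proof (rule tri_middle[of _ "- 1", simplified])
    show "tri 2 1 1 \<in> M"
      by (rule u1_multiple[OF _ u2_powers[of 1], of 1 2]) (simp add: word_nf)
    show "tri 2 2 1 \<in> M"
      by (rule u1_multiple[OF _ tri_p_x_p[of 3], of 1 "- 1"]) (simp add: word_nf)
  qed (simp_all add: tri_trivial tri_x_m_p)
qed (simp_all add: tri_trivial tri_p_x_p)

text \<open>Treats the second summand; the inserted power of \<open>s1\<close> stands for its right
  factor \<open>u1\<close>. The next lemma does the same for the third.\<close>

lemma tri_pmp_s1_s2: "tri 1 (- 1) 1 * s1 powi k * s2 \<in> M"
proof (rule four_s1_powers[OF subspace, of _ "- 1", simplified])
  show "tri 1 (- 1) 1 * inverse s1 * s2 \<in> M"
    by (rule u1_multiple[OF _ tri_m2_x_p2[of 2], of "- 1" 0]) (simp add: word_nf)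
  show "tri 1 (- 1) 1 * s2 \<in> M"
    by (rule u1_multiple[OF _ tri_p_m_x[of 2], of 0 0]) (simp add: word_nf)
  show "tri 1 (- 1) 1 * s1 * s2 \<in> M"
    by (rule u1_multiple[OF _ u2_powers[of 2], of 0 1]) (simp add: word_nf)
  show "tri 1 (- 1) 1 * s1\<^sup>2 * s2 \<in> M"
    by (rule u1_multiple[OF _ tri_p_x_p[of 3], of 1 "- 2"]) (simp add: word_nf)
qed

lemma tri_mpm_s1_s2: "tri (- 1) 1 (- 1) * s1 powi k * s2 \<in> M"
proof (rule four_s1_powers[OF subspace, of _ "- 1", simplified])
  show "tri (- 1) 1 (- 1) * inverse s1 * s2 \<in> M"
    by (rule u1_multiple[OF _ tri_m_x_m[of 2], of 0 "- 1"]) (simp add: word_nf)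
  show "tri (- 1) 1 (- 1) * s2 \<in> M"
    by (rule u1_multiple[OF _ u2_powers[of "- 1"], of 0 1]) (simp add: word_nf)
  show "tri (- 1) 1 (- 1) * s1 * s2 \<in> M"
    by (rule u1_multiple[OF _ tri_m_p[of 2], of 0 "- 1"]) (simp add: word_nf)
  show "tri (- 1) 1 (- 1) * s1\<^sup>2 * s2 \<in> M"
    by (rule u1_multiple[OF _ tri_x_m_p[of 2], of 1 "- 1"]) (simp add: word_nf)
qed

text \<open>The last three summands have no right factor \<open>u1\<close>, so no power of
  \<open>s1\<close> is inserted before \<open>s2\<close>.\<close>

lemma omega_s2: "\<omega> * s2 \<in> M"
  by (rule u1_multiple[OF _ tri_p_x_p[of 3], of "- 1" 1]) (simp add: omega_def word_nf)

lemma inverse_omega_s2: "inverse \<omega> * s2 \<in> M"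
  by (rule u1_multiple[OF _ u2_powers[of "- 1"], of 0 "- 2"]) (simp add: omega_inverse word_nf)

lemma inverse_omega_square_s2: "(inverse \<omega>)\<^sup>2 * s2 \<in> M"
  by (rule u1_multiple[OF _ tri_m_x_m[of "- 3"], of 1 "- 3"]) (simp add: omega_inverse word_nf)

end

section \<open>Right ideals\<close>

text \<open>The images of braids span \<open>H4\<close>, as a finitely supported function is built
  up one coefficient at a time.\<close>

lemma H4_in_subspace:
  assumes K: "H4.subspace K" and braid: "\<And>g. of_braid g \<in> K"
  shows "x \<in> K"
proof -
  have "abs_H4 p \<in> K" for p
  proof (induction p rule: update_induct)
    case const
    show ?case using H4.subspace_0[OF K] by (simp add: zero_H4_def)
  next
    case (update p g r)
    have "Poly_Mapping.update g r p = p + grp_scalar r * grp_elem g"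
      using update by (simp add: update_conv_add grp_scalar_def grp_elem_def mult_single)
    then have "abs_H4 (Poly_Mapping.update g r p) = abs_H4 p + scale_H4 r (of_braid g)"
      by (simp add: plus_H4.abs_eq scale_H4.abs_eq of_braid.abs_eq)
    then show ?case
      using update by (simp add: H4.subspace_add[OF K] H4.subspace_scale[OF K] braid)
  qed
  then show ?thesis by (induct x rule: H4.abs_induct)
qed

text \<open>Closure under the generators gives exponents 0 to 3, hence closure under their inverses
  by the quartic relation, hence under all braid words.\<close>

lemma right_ideal_eq_UNIV:
  assumes K: "H4.subspace K" and one: "1 \<in> K"
    and gen: "\<And>x g. x \<in> K \<Longrightarrow> x * of_braid (braid_gen g) \<in> K"
  shows "K = UNIV"
proof -
  have pow: "x * of_braid (braid_gen g) ^ n \<in> K" if "x \<in> K" for x g n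
    by (induction n) (simp_all add: that gen power_Suc2 flip: mult.assoc del: power_Suc)
  have inv: "x * inverse (of_braid (braid_gen g)) \<in> K" if "x \<in> K" for x g
    using four_consecutive_powers[OF K, of x g 0 1 "- 1"] pow[OF that, of g 1]
      pow[OF that, of g 2] pow[OF that, of g 3] that by simp
  \<comment> \<open>The element \<open>x\<close> stays arbitrary because the induction absorbs the
    first letter of the word into it.\<close>
  have "x * of_braid (abs_braid3 w) \<in> K" if "x \<in> K" for x w
    using that
  proof (induction w arbitrary: x)
    case Nil
    then show ?case by (simp add: of_braid_0 flip: zero_braid3_def)
  next
    case (Cons l w)
    obtain g e where l: "l = (g, e)" by (cases l)
    have letter: "abs_braid3 [l] = (if e then braid_gen g else - braid_gen g)"
      by (simp add: l braid_gen.abs_eq uminus_braid3.abs_eq word_inv_def)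
    have "abs_braid3 (l # w) = abs_braid3 [l] + abs_braid3 w"
      by (simp add: plus_braid3.abs_eq)
    then have "x * of_braid (abs_braid3 (l # w))
        = x * of_braid (abs_braid3 [l]) * of_braid (abs_braid3 w)"
      by (simp add: of_braid_add mult.assoc)
    moreover have "x * of_braid (abs_braid3 [l]) \<in> K"
      using Cons.prems by (simp add: letter of_braid_uminus gen inv)
    ultimately show ?case
      using Cons.IH by simp
  qed
  from this[OF one] have "of_braid g \<in> K" for g
    by (induct g rule: braid3.abs_induct) simp
  then show ?thesis using H4_in_subspace[OF K] by blast
qed

context u1_bimodule
begin

lemma span_prod_subset: "x \<in> M \<Longrightarrow> u1 \<cdot> {x} \<subseteq> M"
  by (rule span_prod_minimal[OF subspace]) (auto intro: left)

lemma span_prod_mult_s2: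
  assumes "x * s2 \<in> M"
  shows "u1 \<cdot> {x} \<subseteq> {z. z * s2 \<in> M}"
  using assms
  by (intro span_prod_minimal H4_subspace_mult_right_preimage subspace) (auto intro: left simp: mult.assoc)

text \<open>Linearity reduces the right factor from \<open>u1\<close> to powers of
  \<open>s1\<close>; the left one is absorbed by \<open>M\<close>.\<close>

lemma span_prod_u1_mult_s2:
  assumes "\<And>x k. x \<in> X \<Longrightarrow> x * s1 powi k * s2 \<in> M"
  shows "u1 \<cdot> X \<cdot> u1 \<subseteq> {z. z * s2 \<in> M}"
proof (intro span_prod_minimal H4_subspace_mult_right_preimage subspace)
  fix y q assume y: "y \<in> u1 \<cdot> X" and q: "q \<in> u1"
  have "x * q * s2 \<in> M" if "x \<in> X" for x
  proof -
    have "q \<in> {q. x * q * s2 \<in> M}"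
      using q by (rule u1_induct) (auto intro: H4_subspace_mult_preimage subspace assms that)
    then show ?thesis by simp
  qed
  then have "u1 \<cdot> X \<subseteq> {y. y * (q * s2) \<in> M}"
    by (intro span_prod_minimal H4_subspace_mult_right_preimage subspace) (auto intro: left simp: mult.assoc)
  then show "y * q \<in> {z. z * s2 \<in> M}"
    using y by (auto simp: mult.assoc)
qed

end

lemma (in u1_bimodule_omega) u2_s1_s2:
  assumes "x \<in> u2"
  shows "x * s1 powi k * s2 \<in> M"
proof -
  have "x \<in> {x. x * (s1 powi k * s2) \<in> M}"
    using assms by (rule u2_induct)
      (use tri_x_x_p in \<open>auto intro: H4_subspace_mult_right_preimage subspace simp: tri_def mult.assoc\<close>)
  then show ?thesis by (simp add: mult.assoc)
qed

lemma subset_plus_left: "u1_bimodule B \<Longrightarrow> S \<subseteq> A \<Longrightarrow> S \<subseteq> A + B"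
  using set_plus_intro[of _ A 0 B] by (auto simp: u1_bimodule_def H4.subspace_0)

lemma subset_plus_right: "u1_bimodule A \<Longrightarrow> S \<subseteq> B \<Longrightarrow> S \<subseteq> A + B"
  using set_plus_intro[of 0 A _ B] by (auto simp: u1_bimodule_def H4.subspace_0)

lemma plus_subset_subspace:
  "H4.subspace K \<Longrightarrow> A \<subseteq> K \<Longrightarrow> B \<subseteq> K \<Longrightarrow> A + B \<subseteq> K"
  by (auto elim!: set_plus_elim intro: H4.subspace_add)

lemma mem_span_prod_u1: "x \<in> X \<Longrightarrow> x \<in> u1 \<cdot> X \<cdot> u1"
  using span_prod_intro[OF span_prod_intro[of 1 u1 x X], of 1 u1] s1_powi_in_u1[of 0] by simp

lemma mem_span_prod: "x \<in> u1 \<cdot> {x}"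
  using span_prod_intro[of 1 u1 x "{x}"] s1_powi_in_u1[of 0] by simp

theorem theorem2p2p3:
  shows "U = u1 \<cdot> u2 \<cdot> u1
           + u1 \<cdot> {s2 * s1 powi -1 * s2} \<cdot> u1
           + u1 \<cdot> {s2 powi -1 * s1 * s2 powi -1} \<cdot> u1
           + u1 \<cdot> {\<omega>}
           + u1 \<cdot> {\<omega> powi -1}
           + u1 \<cdot> {\<omega> powi -2}
         \<and> (UNIV :: H4 set) = U"
proof -
  define A where "A = u1 \<cdot> u2 \<cdot> u1"
  define B where "B = u1 \<cdot> {s2 * s1 powi -1 * s2} \<cdot> u1"
  define C where "C = u1 \<cdot> {s2 powi -1 * s1 * s2 powi -1} \<cdot> u1"
  define D where "D = u1 \<cdot> {\<omega>}"
  define E where "E = u1 \<cdot> {\<omega> powi -1}"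
  define F where "F = u1 \<cdot> {\<omega> powi -2}"
  define G where "G = u1 \<cdot> {s2 * s1 powi -2 * s2} \<cdot> u1"
  define H where "H = u1 \<cdot> {s2 powi -2 * s1 powi -2 * s2 powi -2} \<cdot> u1"
  define W where "W = A + B + C + D + E + F"
  have omega_powi: "\<omega> powi -1 = inverse \<omega>" "\<omega> powi -2 = (inverse \<omega>)\<^sup>2"
    by (simp_all add: power_int_def)
  have words: "s2 * s1 powi -1 * s2 = tri 1 (- 1) 1" "s2 * s1 powi -2 * s2 = tri 1 (- 2) 1"
      "s2 powi -1 * s1 * s2 powi -1 = tri (- 1) 1 (- 1)"
      "s2 powi -1 * s1 powi -2 * s2 powi -1 = inverse \<omega>"
      "s2 powi -2 * s1 powi -2 * s2 powi -2 = tri (- 2) (- 2) (- 2)"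
    by (simp_all add: tri_def omega_inverse)
  \<comment> \<open>The fourth summand of \<open>U\<close> is generated by
    \<open>inverse \<omega>\<close>, so it is \<open>E\<close>.\<close>
  have U: "U = A + B + C + E + G + H"
    by (simp only: U_def A_def B_def C_def E_def G_def H_def omega_powi words(4))
  have bimodules: "u1_bimodule A" "u1_bimodule B" "u1_bimodule C" "u1_bimodule D" "u1_bimodule E"
      "u1_bimodule F" "u1_bimodule G" "u1_bimodule H"
    unfolding A_def B_def C_def D_def E_def F_def G_def H_def omega_powi
    by (intro u1_bimodule_span_prod u1_bimodule_span_prod_commuting
        omega_commute inverse_omega_commute inverse_omega_square_commute)+
  note upper = subset_plus_left subset_plus_right order_refl u1_bimodule_plus bimodules
  have gens: "s2 powi k \<in> A" "tri 1 (- 1) 1 \<in> B" "tri (- 1) 1 (- 1) \<in> C" "\<omega> \<in> D"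
      "tri (- 1) (- 2) (- 1) \<in> E" "(inverse \<omega>)\<^sup>2 \<in> F" "tri 1 (- 2) 1 \<in> G"
      "tri (- 2) (- 2) (- 2) \<in> H" for k
    unfolding A_def B_def C_def D_def E_def F_def G_def H_def omega_powi words omega_inverse[symmetric]
    by (intro mem_span_prod_u1 mem_span_prod s2_powi_in_u2 singletonI)+
  have W_upper: "A \<subseteq> W" "B \<subseteq> W" "C \<subseteq> W" "D \<subseteq> W" "E \<subseteq> W" "F \<subseteq> W"
    unfolding W_def by (meson upper)+
  have U_upper: "A \<subseteq> U" "B \<subseteq> U" "C \<subseteq> U" "E \<subseteq> U" "G \<subseteq> U" "H \<subseteq> U"
    unfolding U by (meson upper)+
  have "u1_bimodule W" "u1_bimodule U"
    unfolding W_def U by (intro u1_bimodule_plus bimodules)+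
  then interpret W: u1_bimodule W + U: u1_bimodule U .
  interpret U: u1_bimodule_words U
    by unfold_locales (use gens U_upper in blast)+
  interpret W: u1_bimodule_omega W
    by unfold_locales (use gens W_upper in blast)+
  have "W \<subseteq> {z. z * s2 \<in> W}"
  proof -
    have "A \<subseteq> {z. z * s2 \<in> W}"
      unfolding A_def by (intro W.span_prod_u1_mult_s2 W.u2_s1_s2)
    moreover have "B \<subseteq> {z. z * s2 \<in> W}" "C \<subseteq> {z. z * s2 \<in> W}"
      unfolding B_def C_def words using W.tri_pmp_s1_s2 W.tri_mpm_s1_s2
      by (auto intro!: W.span_prod_u1_mult_s2)
    moreover have "D \<subseteq> {z. z * s2 \<in> W}" "E \<subseteq> {z. z * s2 \<in> W}" "F \<subseteq> {z. z * s2 \<in> W}"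
      unfolding D_def E_def F_def omega_powi
      by (intro W.span_prod_mult_s2 W.omega_s2 W.inverse_omega_s2 W.inverse_omega_square_s2)+
    ultimately have "A + B + C + D + E + F \<subseteq> {z. z * s2 \<in> W}"
      by (intro plus_subset_subspace H4_subspace_mult_right_preimage W.subspace)
    then show ?thesis by (simp only: W_def)
  qed
  then have "x * s2 \<in> W" if "x \<in> W" for x
    using that by auto
  moreover have "x * s1 \<in> W" if "x \<in> W" for x
    using W.right[OF s1_powi_in_u1[of 1]] that by simp
  moreover have "1 \<in> W"
    using W.u2_powers[of 0] by simp
  ultimately have "W = UNIV"
    by (intro right_ideal_eq_UNIV W.subspace) (metis gen.exhaust s1_def s2_def)+
  \<comment> \<open>As \<open>W\<close> is all of \<open>H4\<close>, this one inclusion yields both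
    (i) and (ii).\<close>
  moreover have "W \<subseteq> U"
  proof -
    \<comment> \<open>The two equivalences turn the generators of \<open>G\<close> and
      \<open>H\<close> into those of \<open>D\<close> and \<open>F\<close>.\<close>
    have "\<omega> \<in> U" "inverse \<omega> \<in> U" "(inverse \<omega>)\<^sup>2 \<in> U"
      using gens U_upper U.omega_iff U.inverse_omega_square_iff omega_inverse by auto
    then have "D \<subseteq> U" "E \<subseteq> U" "F \<subseteq> U"
      unfolding D_def E_def F_def omega_powi by (simp_all add: U.span_prod_subset)
    then show ?thesis
      unfolding W_def by (intro plus_subset_subspace U.subspace U_upper)
  qed
  ultimately show ?thesis
    by (auto simp: W_def A_def B_def C_def D_def E_def F_def)
qed

end
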